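(* For each integer $n\ge 1$, the zeros of the polynomial $L_n$ have the form $$\pm\sqrt{2\pm\sqrt{2\pm\sqrt{2\pm\cdots\pm\sqrt{2}}}}$$ with exactly $n$ nested square roots; that is, the zeros of $L_n$ are the numbers $\varepsilon_1\sqrt{2+\varepsilon_2\sqrt{2+\varepsilon_3\sqrt{2+\cdots+\varepsilon_n\sqrt{2}}}}$, where each sign $\varepsilon_1,\dots,\varepsilon_n\in\{+1,-1\}$ is chosen independently.
   Context: The Lucas-Lehmer polynomials $L_n$ (real polynomials in $x$) are defined by $L_0(x)=x$ and $L_n(x)=L_{n-1}(x)^2-2$ for $n\ge 1$. For $n=1$ the displayed expression is $\pm\sqrt{2}$, for $n=2$ it is $\pm\sqrt{2\pm\sqrt{2}}$, and so on. *)

theory Defs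
  imports "HOL-Computational_Algebra.Polynomial"
begin

primrec lucas_lehmer_poly :: "nat \<Rightarrow> real poly" where
  "lucas_lehmer_poly 0 = [:0, 1:]"
| "lucas_lehmer_poly (Suc n) = (lucas_lehmer_poly n)\<^sup>2 - 2"

definition sign_lists :: "nat \<Rightarrow> real list set" where
  "sign_lists n = {es. length es = n \<and> set es \<subseteq> {1, -1}}"

(* nested_radical [e1, ..., en] = e1 * sqrt (2 + e2 * sqrt (2 + ... + en * sqrt 2)), with one
   square root per list entry.  The value 0 at [] makes the innermost term en * sqrt (2 + 0).
   The library function sqrt is total on the reals (sqrt (-x) = - sqrt x), so the expression
   denotes the intended radical only if each radicand
   2 + nested_radical (drop k es), 1 <= k <= length es, is nonnegative. *)
primrec nested_radical :: "real list \<Rightarrow> real" where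
  "nested_radical [] = 0"
| "nested_radical (e # es) = e * sqrt (2 + nested_radical es)"

end

theory Submission
  imports Defs
begin

text \<open>
  \<open>L\<^sub>n\<close> is the \<open>n\<close>-th iterate of \<open>w \<mapsto> w\<^sup>2 - 2\<close>. The recursion applies this map last,
  whereas the nested radicals arise when it is applied first:
  \<open>L\<^sub>n\<^sub>+\<^sub>1(z) = L\<^sub>n(z\<^sup>2 - 2)\<close>. Hence \<open>z\<close> is a zero of \<open>L\<^sub>n\<^sub>+\<^sub>1\<close> iff \<open>z\<^sup>2 - 2\<close> is a zero \<open>r\<close> of
  \<open>L\<^sub>n\<close>, that is, iff \<open>z\<close> is one of the two square roots of \<open>2 + r\<close>, and each step of this
  recursion adds an outermost sign and radical.

  All radicands are nonnegative because nested radicals never leave \<open>[-2, 2]\<close>: if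
  \<open>\<bar>r\<bar> \<le> 2\<close>, then \<open>0 \<le> 2 + r \<le> 4\<close>, so \<open>sqrt (2 + r)\<close> lies in \<open>[0, 2]\<close>. Consequently
  the two square roots of \<open>2 + r\<close> in the complex numbers are already real. The
  zeros are therefore determined over an arbitrary field extending the reals
  (\<open>lucas_lehmer_zeros\<close>); the real numbers give the set of zeros and the complex numbers
  show that there are no others.
\<close>

lemma map_poly_of_real_mult:
  "map_poly of_real (p * q) =
    (map_poly of_real p * map_poly of_real q :: 'a :: {real_algebra_1, comm_ring_1} poly)"
  by (rule poly_eqI) (simp add: coeff_map_poly coeff_mult)

lemma map_poly_of_real_diff:
  "map_poly of_real (p - q) =
    (map_poly of_real p - map_poly of_real q :: 'a :: {real_algebra_1, comm_ring_1} poly)"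
  by (rule poly_eqI) (simp add: coeff_map_poly)

lemma poly_lucas_lehmer_eq_iterate:
  fixes z :: "'a :: {real_algebra_1, comm_ring_1}"
  shows "poly (map_poly of_real (lucas_lehmer_poly n)) z = ((\<lambda>w. w\<^sup>2 - 2) ^^ n) z"
proof (induction n)
  case 0
  show ?case by (simp add: map_poly_pCons)
next
  case (Suc n)
  have "map_poly of_real (2 :: real poly) = (2 :: 'a poly)"
    by (simp add: numeral_poly map_poly_pCons)
  with Suc.IH show ?case
    by (simp add: map_poly_of_real_diff map_poly_of_real_mult power2_eq_square)
qed

lemma poly_lucas_lehmer_Suc:
  fixes z :: "'a :: {real_algebra_1, comm_ring_1}"
  shows "poly (map_poly of_real (lucas_lehmer_poly (Suc n))) z =
    poly (map_poly of_real (lucas_lehmer_poly n)) (z\<^sup>2 - 2)"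
  by (simp only: poly_lucas_lehmer_eq_iterate funpow_Suc_right o_apply)

lemma abs_nested_radical_le_2:
  assumes "set es \<subseteq> {1, -1}"
  shows "\<bar>nested_radical es\<bar> \<le> 2"
  using assms
proof (induction es)
  case Nil
  show ?case by simp
next
  case (Cons e es)
  then have "\<bar>nested_radical es\<bar> \<le> 2" and e: "\<bar>e\<bar> = 1" by auto
  then have "0 \<le> 2 + nested_radical es" and "sqrt (2 + nested_radical es) \<le> 2"
    by (auto intro: real_le_lsqrt)
  then show ?case using e by (simp add: abs_mult)
qed

lemma nested_radical_image_Suc:
  "nested_radical ` sign_lists (Suc n) =
    (\<Union>r \<in> nested_radical ` sign_lists n. {sqrt (2 + r), - sqrt (2 + r)})"
proof -
  have "sign_lists (Suc n) = (\<Union>es \<in> sign_lists n. {1 # es, (-1) # es})"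
    by (auto simp: sign_lists_def length_Suc_conv)
  then show ?thesis by (simp add: image_UN)
qed

text \<open>
  The induction needs the zeros of \<open>L\<^sub>n\<close> at every point of the field, as it passes from \<open>z\<close> to
  \<open>z\<^sup>2 - 2\<close>. The result is the same in every field over the reals: the square roots of
  \<open>2 + r\<close> exist because this number is real and nonnegative, and a field contains at
  most two of them.
\<close>

lemma lucas_lehmer_zeros:
  fixes z :: "'a :: real_field"
  shows "poly (map_poly of_real (lucas_lehmer_poly n)) z = 0 \<longleftrightarrow>
    z \<in> of_real ` nested_radical ` sign_lists n"
proof (induction n arbitrary: z)
  case 0
  have "sign_lists 0 = {[]}" by (auto simp: sign_lists_def)
  then show ?case by (simp add: map_poly_pCons)
next
  case (Suc n)
  have root: "z\<^sup>2 - 2 = of_real r \<longleftrightarrow> z \<in> of_real ` {sqrt (2 + r), - sqrt (2 + r)}"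
    if "r \<in> nested_radical ` sign_lists n" for r
  proof -
    have "\<bar>r\<bar> \<le> 2"
      using that abs_nested_radical_le_2 by (auto simp: sign_lists_def)
    then have "(of_real (sqrt (2 + r)) :: 'a)\<^sup>2 = of_real (2 + r)"
      by (simp flip: of_real_power)
    then have "z\<^sup>2 - 2 = of_real r \<longleftrightarrow> z\<^sup>2 = (of_real (sqrt (2 + r)))\<^sup>2"
      by (simp add: algebra_simps)
    then show ?thesis by (simp add: power2_eq_iff)
  qed
  have "poly (map_poly of_real (lucas_lehmer_poly (Suc n))) z = 0 \<longleftrightarrow>
      (\<exists>r \<in> nested_radical ` sign_lists n. z\<^sup>2 - 2 = of_real r)"
    by (simp only: poly_lucas_lehmer_Suc Suc.IH image_iff)
  also have "\<dots> \<longleftrightarrow>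
      (\<exists>r \<in> nested_radical ` sign_lists n. z \<in> of_real ` {sqrt (2 + r), - sqrt (2 + r)})"
    using root by (rule bex_cong[OF refl])
  also have "\<dots> \<longleftrightarrow> z \<in> of_real ` nested_radical ` sign_lists (Suc n)"
    unfolding nested_radical_image_Suc by blast
  finally show ?case .
qed

theorem proposition1:
  fixes n :: nat
  assumes "n \<ge> 1"
  shows "{x :: real. poly (lucas_lehmer_poly n) x = 0} = nested_radical ` sign_lists n
    \<and> (\<forall>z :: complex. poly (map_poly complex_of_real (lucas_lehmer_poly n)) z = 0 \<longrightarrow> z \<in> \<real>)
    \<and> (\<forall>es \<in> sign_lists n. \<forall>k \<in> {1..n}. 0 \<le> 2 + nested_radical (drop k es))"
proof (intro conjI)
  have "map_poly of_real p = p" for p :: "real poly"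
    by (rule poly_eqI) (simp add: coeff_map_poly)
  then show "{x :: real. poly (lucas_lehmer_poly n) x = 0} = nested_radical ` sign_lists n"
    using lucas_lehmer_zeros[of n, where 'a = real] by auto
  show "\<forall>z :: complex. poly (map_poly complex_of_real (lucas_lehmer_poly n)) z = 0 \<longrightarrow> z \<in> \<real>"
    by (auto simp: lucas_lehmer_zeros)
  show "\<forall>es \<in> sign_lists n. \<forall>k \<in> {1..n}. 0 \<le> 2 + nested_radical (drop k es)"
  proof (intro ballI)
    fix es k
    assume "es \<in> sign_lists n"
    then have "set (drop k es) \<subseteq> {1, -1}"
      using set_drop_subset[of k es] by (auto simp: sign_lists_def)
    from abs_nested_radical_le_2[OF this] show "0 \<le> 2 + nested_radical (drop k es)"
      by linarith
  qed
qed

end
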